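(* Let $\mathbf{k}$ be a field of characteristic $0$ and let $(A,\mu,\alpha)$ be a multiplicative Hom-flexible algebra over $\mathbf{k}$. Then $A$ is Hom-power associative if and only if it satisfies $x^4=\alpha(x^2)\alpha(x^2)$ for all $x\in A$.
   Context: A Hom-algebra $(A,\mu,\alpha)$ over $\mathbf{k}$ is a $\mathbf{k}$-vector space $A$ with a bilinear map $\mu\colon A^{\otimes 2}\to A$ (no associativity assumed; write $xy=\mu(x,y)$) and a linear map $\alpha\colon A\to A$. It is multiplicative if $\alpha(xy)=\alpha(x)\alpha(y)$ for all $x,y$. Here $\alpha^n$ is the $n$-fold composition, $\alpha^0=Id$. Hom-powers: $x^1=x$ and $x^n=x^{n-1}\alpha^{n-2}(x)$ for $n\ge 2$ (so $x^2=xx$, $x^4=((xx)\alpha(x))\alpha^2(x)$). $A$ is $n$th Hom-power associative if $x^n=\alpha^{n-i-1}(x^i)\,\alpha^{i-1}(x^{n-i})$ for all $x\in A$ and $i\in\{1,\dots,n-1\}$, and Hom-power associative if this holds for all $n\ge 2$. The Hom-associator is $as_A(x,y,z)=(xy)\alpha(z)-\alpha(x)(yz)$. A Hom-algebra is Hom-flexible if $as_A(x,y,x)=0$ for all $x,y\in A$. *)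

theory Defs
  imports Complex_Main
begin

locale hom_algebra = vector_space scale
  for scale :: "'k::field \<Rightarrow> 'a::ab_group_add \<Rightarrow> 'a" +
  fixes mu :: "'a \<Rightarrow> 'a \<Rightarrow> 'a" and alpha :: "'a \<Rightarrow> 'a"
  assumes mu_linear_right: "\<And>x. Vector_Spaces.linear scale scale (\<lambda>y. mu x y)"
    and mu_linear_left: "\<And>y. Vector_Spaces.linear scale scale (\<lambda>x. mu x y)"
    and alpha_linear: "Vector_Spaces.linear scale scale alpha"

locale multiplicative_hom_algebra = hom_algebra scale mu alpha
  for scale :: "'k::field \<Rightarrow> 'a::ab_group_add \<Rightarrow> 'a"
    and mu :: "'a \<Rightarrow> 'a \<Rightarrow> 'a" and alpha :: "'a \<Rightarrow> 'a" +
  assumes alpha_mult: "\<And>x y. alpha (mu x y) = mu (alpha x) (alpha y)"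

text \<open>Hom-powers are defined for exponents at least 1; the value at exponent 0 is a dummy.
  The third equation is \<open>x^n = x^(n-1) alpha^(n-2)(x)\<close> with n replaced by n + 2.\<close>

fun hom_power :: "('a::zero \<Rightarrow> 'a \<Rightarrow> 'a) \<Rightarrow> ('a \<Rightarrow> 'a) \<Rightarrow> 'a \<Rightarrow> nat \<Rightarrow> 'a" where
  "hom_power mu alpha x 0 = 0"
| "hom_power mu alpha x (Suc 0) = x"
| "hom_power mu alpha x (Suc (Suc n)) = mu (hom_power mu alpha x (Suc n)) ((alpha ^^ n) x)"

definition nth_hom_power_associative ::
  "('a::zero \<Rightarrow> 'a \<Rightarrow> 'a) \<Rightarrow> ('a \<Rightarrow> 'a) \<Rightarrow> nat \<Rightarrow> bool" where
  "nth_hom_power_associative mu alpha n \<longleftrightarrow>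
    (\<forall>x. \<forall>i\<in>{1..n - 1}.
      hom_power mu alpha x n =
        mu ((alpha ^^ (n - i - 1)) (hom_power mu alpha x i))
           ((alpha ^^ (i - 1)) (hom_power mu alpha x (n - i))))"

definition hom_power_associative :: "('a::zero \<Rightarrow> 'a \<Rightarrow> 'a) \<Rightarrow> ('a \<Rightarrow> 'a) \<Rightarrow> bool" where
  "hom_power_associative mu alpha \<longleftrightarrow> (\<forall>n\<ge>2. nth_hom_power_associative mu alpha n)"

definition hom_associator ::
  "('a::ab_group_add \<Rightarrow> 'a \<Rightarrow> 'a) \<Rightarrow> ('a \<Rightarrow> 'a) \<Rightarrow> 'a \<Rightarrow> 'a \<Rightarrow> 'a \<Rightarrow> 'a" where
  "hom_associator mu alpha x y z = mu (mu x y) (alpha z) - mu (alpha x) (mu y z)"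

definition hom_flexible :: "('a::ab_group_add \<Rightarrow> 'a \<Rightarrow> 'a) \<Rightarrow> ('a \<Rightarrow> 'a) \<Rightarrow> bool" where
  "hom_flexible mu alpha \<longleftrightarrow> (\<forall>x y. hom_associator mu alpha x y x = 0)"

end

theory Submission
  imports Defs
begin

text \<open>
  The forward implication is the case \<open>n = 4\<close>, \<open>i = 2\<close> of the definition. The converse
  transports Albert's argument for power associative algebras to the Hom setting. Because \<open>\<alpha>\<close> is
  multiplicative, the twists are pure bookkeeping once \<open>x\<^sup>i\<close> is replaced by
  \<open>P\<^sub>l(i) = \<alpha>\<^bsup>l-i\<^esup>(x\<^sup>i)\<close>, its copy at \<^emph>\<open>level\<close> \<open>l\<close>: the map \<open>\<alpha>\<close> raises the level by one,
  and so should a product of two factors at the same level.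

  Fix \<open>x\<close> and assume that the products of degree below \<open>n\<close> already agree. In degree \<open>n\<close>
  everything depends on the elements \<open>M(i) = P\<^bsub>n-1\<^esub>(i) P\<^bsub>n-1\<^esub>(n-i)\<close>, and \<open>x\<^sup>n = M(n-1)\<close>.
  Two linearized identities relate them.

  \<^item> Linearized flexibility says that the commutator \<open>M(i) - M(n-i)\<close> does not depend on \<open>i\<close>. It
    changes sign under \<open>i \<mapsto> n-i\<close>, so it is zero and \<open>M(i) = M(n-i)\<close>
    (\<open>complementary_powers_commute\<close>).

  \<^item> Polarizing \<open>x\<^sup>4 = \<alpha>(x\<^sup>2) \<alpha>(x\<^sup>2)\<close> and inserting powers with exponents \<open>1, 1, a, n-2-a\<close>
    (\<open>polarized_fourth_power\<close>) gives
    \<open>4 M(2) + 8 M(a+1) = 6 M(1) + 3 M(a) + 3 M(a+2)\<close>.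

  The second relation is a linear recurrence for the deviations \<open>M(i) - M(1)\<close>, which makes each of
  them a multiple of \<open>M(2) - M(1)\<close> by a rational number that is positive for \<open>i \<ge> 2\<close>. But the
  deviation at \<open>i = n-1\<close> vanishes by symmetry, so all of them vanish
  (\<open>recurrence_forces_zero\<close>), and every product of degree \<open>n\<close> equals \<open>x\<^sup>n\<close>.
\<close>

section \<open>Polarization of a quartic form\<close>

text \<open>
  The sum runs over the twelve arrangements of \<open>x, x, y, z\<close>. Replacing the argument of the form by
  \<open>x + y\<close> and by \<open>x - y\<close> and adding isolates the part quadratic in \<open>y\<close>, at the price of a factor
  2; this part is then linearized in \<open>y\<close>. Stopping at this partial polarization avoids the full
  expansion of the form at a sum of four vectors.
\<close>

lemma polarize_quartic_diagonal:
  fixes g :: "'a::ab_group_add \<Rightarrow> 'a \<Rightarrow> 'a \<Rightarrow> 'a \<Rightarrow> 'b::ab_group_add"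
  assumes add1: "\<And>b c d. additive (\<lambda>a. g a b c d)"
    and add2: "\<And>a c d. additive (\<lambda>b. g a b c d)"
    and add3: "\<And>a b d. additive (\<lambda>c. g a b c d)"
    and add4: "\<And>a b c. additive (\<lambda>d. g a b c d)"
    and no_2_torsion: "\<And>v::'b. v + v = 0 \<Longrightarrow> v = 0"
    and diagonal: "\<And>x. g x x x x = 0"
  shows "g x x y z + g x x z y + g y z x x + g z y x x
       + g x y x z + g x y z x + g y x x z + g y x z x
       + g x z x y + g x z y x + g z x x y + g z x y x = 0"
proof -
  note adds = add1[THEN additive.add] add2[THEN additive.add]
    add3[THEN additive.add] add4[THEN additive.add]
  note minuses = add1[THEN additive.minus] add2[THEN additive.minus]
    add3[THEN additive.minus] add4[THEN additive.minus]
  define q where "q y = g x x y y + g y y x x + g x y x y + g x y y x + g y x x y + g y x y x" for y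
  have q: "q y = 0" for y
  proof (rule no_2_torsion)
    define odd_part where "odd_part = g y x x x + g x y x x + g x x y x + g x x x y
              + g x y y y + g y x y y + g y y x y + g y y y x"
    have "g (x + y) (x + y) (x + y) (x + y) = g x x x x + g y y y y + q y + odd_part"
      unfolding q_def odd_part_def by (simp only: adds add_ac)
    moreover have "g (x + - y) (x + - y) (x + - y) (x + - y) = g x x x x + g y y y y + q y + - odd_part"
      unfolding q_def odd_part_def by (simp only: adds minuses minus_minus minus_add_distrib add_ac)
    ultimately have "q y + odd_part = 0" "q y + - odd_part = 0"
      unfolding diagonal by simp_all
    then show "q y + q y = 0"
      by (simp add: eq_neg_iff_add_eq_0[symmetric])
  qed
  have "q (y + z) = q y + q z + (g x x y z + g x x z y + g y z x x + g z y x x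
       + g x y x z + g x y z x + g y x x z + g y x z x
       + g x z x y + g x z y x + g z x x y + g z x y x)"
    unfolding q_def by (simp only: adds add_ac)
  then show ?thesis
    by (simp only: q add_0)
qed

section \<open>The recurrence for the deviations\<close>

text \<open>
  The factors by which \<open>M(2) - M(1)\<close> is multiplied; index \<open>i\<close> belongs to \<open>M(i+1) - M(1)\<close>.
\<close>

fun deviation_coeff :: "nat \<Rightarrow> rat" where
  "deviation_coeff 0 = 0"
| "deviation_coeff (Suc 0) = 1"
| "deviation_coeff (Suc (Suc i)) = (8 * deviation_coeff (Suc i) - 3 * deviation_coeff i + 4) / 3"

text \<open>
  Monotonicity carries its own induction: the next increment is
  \<open>(5 k\<^bsub>i+1\<^esub> - 3 k\<^sub>i + 4) / 3\<close>, which is positive as soon as \<open>0 \<le> k\<^sub>i < k\<^bsub>i+1\<^esub>\<close>.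
\<close>

lemma deviation_coeff_increasing:
  "0 \<le> deviation_coeff i \<and> deviation_coeff i < deviation_coeff (Suc i)"
  by (induction i) (simp_all add: field_simps)

locale flexible_hom_algebra = multiplicative_hom_algebra scale mu alpha
  for scale :: "'k::field_char_0 \<Rightarrow> 'a::ab_group_add \<Rightarrow> 'a"
    and mu :: "'a \<Rightarrow> 'a \<Rightarrow> 'a" and alpha :: "'a \<Rightarrow> 'a" +
  assumes flexible: "hom_flexible mu alpha"
begin

lemma scale_of_nat_Suc: "scale (of_nat (Suc n)) v = v + scale (of_nat n) v"
  by (simp add: scale_left_distrib)

lemma scale_small:
  "scale 2 v = v + v"
  "scale 3 v = v + v + v"
  "scale 4 v = v + v + v + v"
  "scale 6 v = v + v + v + v + v + v"
  "scale 8 v = v + v + v + v + v + v + v + v"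
  using scale_of_nat_Suc[of 1 v] scale_of_nat_Suc[of 2 v] scale_of_nat_Suc[of 3 v]
    scale_of_nat_Suc[of 4 v] scale_of_nat_Suc[of 5 v] scale_of_nat_Suc[of 6 v]
    scale_of_nat_Suc[of 7 v]
  by (simp_all add: algebra_simps)

lemma no_2_torsion: "(v::'a) + v = 0 \<Longrightarrow> v = 0"
  using scale_eq_0_iff[of 2 v] by (simp add: scale_small)

lemma mu_add_left: "mu (x + y) z = mu x z + mu y z"
  and mu_add_right: "mu x (y + z) = mu x y + mu x z"
  and alpha_add: "alpha (x + y) = alpha x + alpha y"
  using mu_linear_left mu_linear_right alpha_linear
  by (simp_all add: Vector_Spaces.linear_iff)

lemma alpha_pow_mult: "(alpha ^^ k) (mu x y) = mu ((alpha ^^ k) x) ((alpha ^^ k) y)"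
  by (induction k) (simp_all add: alpha_mult)

text \<open>
  The recurrence determines the sequence up to the factor \<open>e 1\<close>, and the coefficient at \<open>N \<ge> 1\<close>
  is positive, hence invertible in characteristic 0; so \<open>e N = 0\<close> forces \<open>e 1 = 0\<close>.
\<close>

lemma recurrence_forces_zero:
  fixes e :: "nat \<Rightarrow> 'a"
  assumes start: "e 0 = 0"
    and recurrence: "\<And>i. i + 2 \<le> N \<Longrightarrow>
      scale 3 (e (i + 2)) = scale 8 (e (i + 1)) - scale 3 (e i) + scale 4 (e 1)"
    and finish: "e N = 0" and "N \<ge> 1" and "i \<le> N"
  shows "e i = 0"
proof -
  have multiple: "i \<le> N \<Longrightarrow> e i = scale (of_rat (deviation_coeff i)) (e 1)" for i
  proof (induction i rule: deviation_coeff.induct)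
    case (3 i)
    let ?k = "\<lambda>i. of_rat (deviation_coeff i) :: 'k"
    have IH: "e i = scale (?k i) (e 1)" "e (Suc i) = scale (?k (Suc i)) (e 1)"
      using 3 by simp_all
    have "scale 3 (e (i + 2)) = scale 8 (e (i + 1)) - scale 3 (e i) + scale 4 (e 1)"
      using recurrence 3(3) by simp
    also have "\<dots> = scale (8 * ?k (Suc i) - 3 * ?k i + 4) (e 1)"
      unfolding Suc_eq_plus1[symmetric] IH
      by (simp add: scale_left_distrib scale_left_diff_distrib)
    also have "\<dots> = scale 3 (scale (?k (Suc (Suc i))) (e 1))"
      by (simp add: of_rat_divide of_rat_add of_rat_diff of_rat_mult)
    finally show ?case
      by (simp del: scale_scale deviation_coeff.simps)
  qed (use start in simp_all)
  have "deviation_coeff N > 0"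
    using deviation_coeff_increasing[of "N - 1"] \<open>N \<ge> 1\<close> by simp
  then have "e 1 = 0"
    using multiple[of N] finish by simp
  then show ?thesis
    using multiple[OF \<open>i \<le> N\<close>] by simp
qed

section \<open>Powers at a common level\<close>

text \<open>
  The copy of \<open>x\<^sup>i\<close> at level \<open>l\<close>, meaningful for \<open>1 \<le> i \<le> l\<close>. Multilinear identities can only be
  applied to powers of different exponents after these have been brought to one level.
\<close>

definition twisted_power :: "'a \<Rightarrow> nat \<Rightarrow> nat \<Rightarrow> 'a" where
  "twisted_power x l i = (alpha ^^ (l - i)) (hom_power mu alpha x i)"

lemma alpha_twisted_power: "i \<le> l \<Longrightarrow> alpha (twisted_power x l i) = twisted_power x (Suc l) i"
  by (simp add: twisted_power_def Suc_diff_le)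

definition powers_multiply :: "'a \<Rightarrow> nat \<Rightarrow> bool" where
  "powers_multiply x n \<longleftrightarrow> (\<forall>i j. 1 \<le> i \<longrightarrow> 1 \<le> j \<longrightarrow> i + j = n \<longrightarrow>
     mu (twisted_power x (n - 1) i) (twisted_power x (n - 1) j) = hom_power mu alpha x n)"

text \<open>
  The induction on the exponent works with one fixed \<open>x\<close>, and symmetrically in the two exponents,
  which is why Hom-power associativity is restated pointwise.
\<close>

lemma nth_hom_power_associative_iff:
  "nth_hom_power_associative mu alpha n \<longleftrightarrow> (\<forall>x. powers_multiply x n)"
proof -
  have "powers_multiply x n \<longleftrightarrow> (\<forall>i\<in>{1..n - 1}.
      hom_power mu alpha x n =
        mu ((alpha ^^ (n - i - 1)) (hom_power mu alpha x i))
           ((alpha ^^ (i - 1)) (hom_power mu alpha x (n - i))))" (is "?L \<longleftrightarrow> ?R") for x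
  proof
    assume L: ?L
    show ?R
    proof
      fix i assume i: "i \<in> {1..n - 1}"
      then have "n - 1 - (n - i) = i - 1" "n - 1 - i = n - i - 1" "i + (n - i) = n" "1 \<le> n - i"
        by auto
      then show "hom_power mu alpha x n =
        mu ((alpha ^^ (n - i - 1)) (hom_power mu alpha x i))
           ((alpha ^^ (i - 1)) (hom_power mu alpha x (n - i)))"
        using L[unfolded powers_multiply_def, rule_format, of i "n - i"] i
        by (simp add: twisted_power_def)
    qed
  next
    assume R: ?R
    show ?L
      unfolding powers_multiply_def
    proof (intro allI impI)
      fix i j assume ij: "1 \<le> i" "1 \<le> j" "i + j = n"
      then have "n - 1 - j = i - 1" "n - 1 - i = n - i - 1" "n - i = j" "i \<in> {1..n - 1}"
        by auto
      then show "mu (twisted_power x (n - 1) i) (twisted_power x (n - 1) j) = hom_power mu alpha x n"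
        using R by (simp add: twisted_power_def)
    qed
  qed
  then show ?thesis
    by (simp add: nth_hom_power_associative_def)
qed

text \<open>
  A product rule at the lowest possible level spreads to all higher levels, since powers of \<open>\<alpha>\<close> are
  multiplicative.
\<close>

lemma twisted_power_mult:
  assumes "powers_multiply x (i + j)" and "1 \<le> i" "1 \<le> j" "i + j \<le> Suc l"
  shows "mu (twisted_power x l i) (twisted_power x l j) = twisted_power x (Suc l) (i + j)"
proof -
  have split: "l - i = (Suc l - (i + j)) + (i + j - 1 - i)" "l - j = (Suc l - (i + j)) + (i + j - 1 - j)"
    using assms by auto
  have "twisted_power x (Suc l) (i + j) = (alpha ^^ (Suc l - (i + j)))
      (mu (twisted_power x (i + j - 1) i) (twisted_power x (i + j - 1) j))"
    using assms unfolding powers_multiply_def twisted_power_def[of x "Suc l"] by simp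
  then show ?thesis
    unfolding twisted_power_def alpha_pow_mult split funpow_add by simp
qed

section \<open>Consequences of flexibility and of the quartic identity\<close>

lemma linearized_flexible:
  "mu (mu a b) (alpha c) + mu (mu c b) (alpha a) = mu (alpha a) (mu b c) + mu (alpha c) (mu b a)"
proof -
  have flex: "mu (mu u b) (alpha u) = mu (alpha u) (mu b u)" for u
    using flexible by (simp add: hom_flexible_def hom_associator_def)
  show ?thesis
    using flex[of "a + c"] flex[of a] flex[of c]
    by (simp add: mu_add_left mu_add_right alpha_add algebra_simps)
qed

text \<open>
  Linearized flexibility applied to the powers with exponents \<open>i\<close>, \<open>1\<close>, \<open>n-i-1\<close> shows that the
  commutators of complementary powers agree for \<open>i\<close> and \<open>i+1\<close>. A commutator that is both
  independent of \<open>i\<close> and antisymmetric under \<open>i \<mapsto> n-i\<close> is zero.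
\<close>

lemma complementary_powers_commute:
  assumes lower: "\<And>m. 2 \<le> m \<Longrightarrow> m < n \<Longrightarrow> powers_multiply x m"
    and "1 \<le> i" "1 \<le> j" "i + j = n"
  shows "mu (twisted_power x (n - 1) i) (twisted_power x (n - 1) j)
       = mu (twisted_power x (n - 1) j) (twisted_power x (n - 1) i)"
proof -
  let ?P = "twisted_power x (n - 1)"
  define c where "c i = mu (?P i) (?P (n - i)) - mu (?P (n - i)) (?P i)" for i
  have shift: "c i = c (Suc i)" if "1 \<le> i" "Suc i < n" for i
  proof -
    \<comment> \<open>The Hom-associator raises the level by two, so its arguments start at level \<open>n-2\<close>.\<close>
    let ?Q = "twisted_power x (n - 2)"
    have n: "n - 1 = Suc (n - 2)" using that by simp
    have P: "alpha (?Q k) = ?P k" if "k \<le> n - 2" for k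
      unfolding n using alpha_twisted_power[OF that] .
    have prod: "mu (?Q k) (?Q l) = ?P (k + l)" if "1 \<le> k" "1 \<le> l" "k + l < n" for k l
      unfolding n using that lower by (intro twisted_power_mult) auto
    let ?k = "n - Suc i"
    have "n - i = Suc ?k" using that by simp
    then show ?thesis
      using linearized_flexible[of "?Q i" "?Q 1" "?Q ?k"] that
      by (simp add: P prod c_def algebra_simps)
  qed
  have const: "c i = c 1" if "1 \<le> i" "i < n" for i
    using that
  proof (induction i rule: dec_induct)
    case (step i)
    then show ?case using shift[of i] by simp
  qed simp
  have "n - i = j" and "n - j = i" and "i < n" and "j < n"
    using assms by auto
  have "c j = - c i"
    using \<open>n - i = j\<close> \<open>n - j = i\<close> by (simp add: c_def)
  moreover have "c j = c i"
    using const[of i] const[of j] assms \<open>i < n\<close> \<open>j < n\<close> by simp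
  ultimately have "c i + c i = 0"
    by (metis add.left_inverse)
  then have "c i = 0"
    by (rule no_2_torsion)
  then show ?thesis
    using assms by (auto simp: c_def)
qed

lemma polarized_fourth_power:
  assumes quartic: "\<And>x. mu (mu (mu x x) (alpha x)) (alpha (alpha x)) = mu (alpha (mu x x)) (alpha (mu x x))"
  defines "g \<equiv> \<lambda>a b c d. mu (mu (mu a b) (alpha c)) (alpha (alpha d)) - mu (alpha (mu a b)) (alpha (mu c d))"
  shows "g x x y z + g x x z y + g y z x x + g z y x x
       + g x y x z + g x y z x + g y x x z + g y x z x
       + g x z x y + g x z y x + g z x x y + g z x y x = 0"
proof (rule polarize_quartic_diagonal[of g, OF _ _ _ _ no_2_torsion])
  show "g x x x x = 0" for x
    using quartic by (simp add: g_def)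
qed (simp_all add: additive_def g_def mu_add_left mu_add_right alpha_add add_diff_add)

section \<open>Induction on the exponent\<close>

text \<open>
  The quartic identity enters through the arguments \<open>x, x, x\<^sup>a, x\<^sup>b\<close> with \<open>a + b = n - 2\<close>: among the
  twelve arrangements, a product of two pairs is \<open>M(2)\<close> four times and \<open>M(a+1)\<close> eight times, while
  the left-normed product depends on its last factor only and is \<open>M(1)\<close> six times and \<open>M(a)\<close> and
  \<open>M(b) = M(a+2)\<close> three times each. Apart from the symmetry of \<open>M\<close>, this is the only input to the
  recurrence.
\<close>

lemma powers_multiply_step:
  assumes quartic: "\<And>x. mu (mu (mu x x) (alpha x)) (alpha (alpha x)) = mu (alpha (mu x x)) (alpha (mu x x))"
    and "n \<ge> 2"
    and lower: "\<And>m. 2 \<le> m \<Longrightarrow> m < n \<Longrightarrow> powers_multiply x m"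
  shows "powers_multiply x n"
proof -
  let ?P = "twisted_power x (n - 1)"
  define M where "M i = mu (?P i) (?P (n - i))" for i
  have sym: "M (n - i) = M i" if "1 \<le> i" "i < n" for i
    using complementary_powers_commute[of n x "n - i" i] lower that by (simp add: M_def)
  have power: "hom_power mu alpha x n = M (n - 1)"
  proof -
    obtain k where "n = Suc (Suc k)" using \<open>n \<ge> 2\<close> by (auto simp: le_iff_add)
    then show ?thesis by (simp add: M_def twisted_power_def)
  qed
  \<comment> \<open>The shift makes the sequence start at index 0 with value 0 and end at index \<open>n-2\<close>.\<close>
  define e where "e i = M (i + 1) - M 1" for i
  have recurrence: "scale 3 (e (i + 2)) = scale 8 (e (i + 1)) - scale 3 (e i) + scale 4 (e 1)"
    if "i + 2 \<le> n - 2" for i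
  proof -
    \<comment> \<open>Products of four factors raise the level by three, so the factors start at level \<open>n-3\<close>.\<close>
    let ?Q = "twisted_power x (n - 3)"
    let ?R = "twisted_power x (n - 2)"
    define a where "a = i + 1"
    define b where "b = n - a - 2"
    have ab: "1 \<le> a" "1 \<le> b" "n = a + b + 2"
      using that by (auto simp: a_def b_def)
    have n: "n - 2 = Suc (n - 3)" "n - 1 = Suc (n - 2)"
      using that by auto
    have Q: "alpha (?Q k) = ?R k" if "k \<le> n - 3" for k
      unfolding n using alpha_twisted_power[OF that] .
    have R: "alpha (?R k) = ?P k" if "k \<le> n - 2" for k
      unfolding n(2) using alpha_twisted_power[OF that] .
    have QQ: "mu (?Q k) (?Q l) = ?R (k + l)" if "1 \<le> k" "1 \<le> l" "k + l \<le> n - 2" for k l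
      unfolding n using that lower ab by (intro twisted_power_mult) auto
    have RR: "mu (?R k) (?R l) = ?P (k + l)" if "1 \<le> k" "1 \<le> l" "k + l \<le> n - 1" for k l
      unfolding n(2) using that lower ab by (intro twisted_power_mult) auto
    define G where "G j k l m = mu (mu (mu (?Q j) (?Q k)) (alpha (?Q l))) (alpha (alpha (?Q m)))
          - mu (alpha (mu (?Q j) (?Q k))) (alpha (mu (?Q l) (?Q m)))" for j k l m
    have G: "G j k l m = M m - M (j + k)"
      if "1 \<le> j" "1 \<le> k" "1 \<le> l" "1 \<le> m" "j + k + l + m = n" for j k l m
    proof -
      have "M m = mu (?P (j + k + l)) (?P m)" "M (j + k) = mu (?P (j + k)) (?P (l + m))"
        using that sym[of m] by (auto simp: M_def)
      then show ?thesis
        using that by (simp add: G_def Q R QQ RR)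
    qed
    have "M (a + b) = M 2" "M (1 + b) = M (a + 1)" "M b = M (a + 2)"
      using sym[of 2] sym[of "a + 1"] sym[of "a + 2"] ab by simp_all
    note reflected = this this(2)[unfolded add.commute[of 1]]
    have total: "G 1 1 a b + G 1 1 b a + G a b 1 1 + G b a 1 1
        + G 1 a 1 b + G 1 a b 1 + G a 1 1 b + G a 1 b 1
        + G 1 b 1 a + G 1 b a 1 + G b 1 1 a + G b 1 a 1 = 0"
      unfolding G_def by (rule polarized_fourth_power[OF quartic])
    have arrangement: "G 1 1 a b = M (a + 2) - M 2" "G 1 1 b a = M a - M 2"
      "G a b 1 1 = M 1 - M 2" "G b a 1 1 = M 1 - M 2"
      "G 1 a 1 b = M (a + 2) - M (a + 1)" "G 1 a b 1 = M 1 - M (a + 1)"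
      "G a 1 1 b = M (a + 2) - M (a + 1)" "G a 1 b 1 = M 1 - M (a + 1)"
      "G 1 b 1 a = M a - M (a + 1)" "G 1 b a 1 = M 1 - M (a + 1)"
      "G b 1 1 a = M a - M (a + 1)" "G b 1 a 1 = M 1 - M (a + 1)"
      using ab reflected by (simp_all add: G add.commute numeral_2_eq_2)
    have "scale 3 (M (a + 2)) + scale 3 (M a) + scale 6 (M 1)
        = scale 8 (M (a + 1)) + scale 4 (M 2)"
      using total unfolding arrangement scale_small by (simp add: algebra_simps)
    then show ?thesis
      by (simp add: e_def a_def scale_small algebra_simps numeral_2_eq_2)
  qed
  show ?thesis
    unfolding powers_multiply_def
  proof (intro allI impI)
    fix i j assume ij: "1 \<le> i" "1 \<le> j" "i + j = n"
    have last: "M (n - 1) = M 1"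
      using sym[of 1] \<open>n \<ge> 2\<close> by simp
    have "M i = M 1"
    proof (cases "n = 2")
      case True
      then have "i = 1" using ij by simp
      then show ?thesis by simp
    next
      case False
      have "Suc (n - 2) = n - 1" "n - 2 \<ge> 1" "i - 1 \<le> n - 2"
        using False ij by auto
      then have "e 0 = 0" "e (n - 2) = 0"
        using last by (simp_all add: e_def)
      then have "e (i - 1) = 0"
        using recurrence_forces_zero[of e "n - 2" "i - 1", OF _ recurrence]
          \<open>n - 2 \<ge> 1\<close> \<open>i - 1 \<le> n - 2\<close> by blast
      then show ?thesis using ij by (simp add: e_def)
    qed
    moreover have "n - i = j" using ij by simp
    ultimately show "mu (?P i) (?P j) = hom_power mu alpha x n"
      unfolding power last by (simp add: M_def)
  qed
qed

lemma powers_multiply_if_quartic: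
  assumes "\<And>x. mu (mu (mu x x) (alpha x)) (alpha (alpha x)) = mu (alpha (mu x x)) (alpha (mu x x))"
    and "n \<ge> 2"
  shows "powers_multiply x n"
  using \<open>n \<ge> 2\<close>
proof (induction n rule: less_induct)
  case (less n)
  show ?case
    using powers_multiply_step[OF assms(1) less.prems] less.IH by blast
qed

end

theorem corollary5p4:
  fixes scale :: "'k::field_char_0 \<Rightarrow> 'a::ab_group_add \<Rightarrow> 'a"
    and mu :: "'a \<Rightarrow> 'a \<Rightarrow> 'a" and alpha :: "'a \<Rightarrow> 'a"
  assumes "multiplicative_hom_algebra scale mu alpha"
    and "hom_flexible mu alpha"
  shows "hom_power_associative mu alpha \<longleftrightarrow>
    (\<forall>x. hom_power mu alpha x 4 =
      mu (alpha (hom_power mu alpha x 2)) (alpha (hom_power mu alpha x 2)))"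
proof -
  interpret flexible_hom_algebra scale mu alpha
    using assms by (simp add: flexible_hom_algebra_def flexible_hom_algebra_axioms_def)
  have low_powers: "hom_power mu alpha x 2 = mu x x"
    "hom_power mu alpha x 4 = mu (mu (mu x x) (alpha x)) (alpha (alpha x))" for x
    by (simp_all add: numeral_eq_Suc)
  show ?thesis
  proof
    assume "hom_power_associative mu alpha"
    then have "nth_hom_power_associative mu alpha 4"
      by (simp add: hom_power_associative_def)
    then show "\<forall>x. hom_power mu alpha x 4 =
        mu (alpha (hom_power mu alpha x 2)) (alpha (hom_power mu alpha x 2))"
      unfolding nth_hom_power_associative_def by (force dest: bspec[where x = 2])
  next
    assume "\<forall>x. hom_power mu alpha x 4 =
        mu (alpha (hom_power mu alpha x 2)) (alpha (hom_power mu alpha x 2))"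
    then show "hom_power_associative mu alpha"
      using powers_multiply_if_quartic
      by (simp add: low_powers hom_power_associative_def nth_hom_power_associative_iff)
  qed
qed

end
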